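(* Let $d\in\mathbb N$, $d\ge 2$. Then the problem $\operatorname{PM}^d_\boxtimes$ is not in the class $\mathsf{LOCAL}(O(\log^* n))$. In particular, $\operatorname{PM}^d_\boxtimes\notin\mathsf{ULOCAL}\big(o(\sqrt[d-1]{1/\varepsilon})\big)$.
   Context: $\mathbb{Z}^d$ denotes the infinite grid: the Cayley graph of the group $\mathbb{Z}^d$ with respect to the standard generators, each edge being oriented and labelled by its generator (isomorphisms preserve this structure). $\mathbb{Z}^d_\boxtimes$ is the graph on the same vertex set in which two different vertices $u=(u_1,\dots,u_d)$ and $v=(v_1,\dots,v_d)$ are connected by an edge if $\sum_{1\le i\le d}|u_i-v_i|\le 2$. $\operatorname{PM}^d_\boxtimes$ is the problem of finding a perfect matching of the graph $\mathbb{Z}^d_\boxtimes$ (each vertex outputs, e.g., the difference vector to its partner), viewed as a locally checkable problem on $\mathbb{Z}^d$; on a finite torus it asks for a perfect matching using the analogous edges (pairs of distinct vertices differing by a vector of $\ell_1$-norm at most $2$). Local algorithms. A deterministic local algorithm of complexity $f(n)$ is a function taking $n$ and a rooted grid of radius $f(n)$ labelled by natural numbers (identifiers), and outputting a label. It is run on finite $d$-dimensional tori with $n$ vertices (side lengths $\Theta(n^{1/d})$, edges oriented and labelled by generators) whose vertices carry unique identifiers from $\{1,\dots,n^{O(1)}\}$, by applying the function to the $f(n)$-hop neighborhood of every vertex. It solves a problem if it always produces a valid solution ($n$ large enough that the relevant balls of the torus are isomorphic to balls of $\mathbb{Z}^d$). $\mathsf{LOCAL}(f(n))$ is the class of problems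 solved by such an algorithm of complexity $f(n)$. $\log^* x$ is the number of times $\log_2$ must be iterated, starting from $x$, to reach a value at most $1$. Uniform local algorithms. A uniform local algorithm (for a problem without inputs, with finite output label set $\Sigma_{out}$) is a pair $\mathcal A=(\mathcal C,f)$, where $\mathcal C$ is a collection of rooted finite-radius neighborhoods in $\mathbb{Z}^d$ with vertices labelled by reals in $[0,1]$, and $f:\mathcal C\to\Sigma_{out}$ is measurable. It is run on $\mathbb{Z}^d$ whose vertices carry independent uniform labels from $[0,1]$: each vertex explores balls of radius $0,1,2,\dots$ around itself until the labelled ball lies in $\mathcal C$, and then outputs the value of $f$. It solves a problem if with probability $1$ every vertex outputs a label and the resulting labelling is a valid solution. The coding radius $R_{\mathcal A}$ is the (random) minimal radius a vertex needs to explore. $\mathcal A$ has uniform complexity $t(\varepsilon)$ if $\mathrm P(R_{\mathcal A}>t(\varepsilon))\le\varepsilon$ for all sufficiently small $\varepsilon>0$. $\mathsf{ULOCAL}(o(g))$ is the class of problems solved by a uniform local algorithm of uniform complexity $t(\varepsilon)$ for some $t$ with $t(\varepsilon)/g(\varepsilon)\to0$ as $\varepsilon\to0$. *)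

theory Defs
  imports "HOL-Probability.Probability" "HOL-Library.Landau_Symbols"
begin

section \<open>Grids and tori\<close>

text \<open>
  The group of dimension d is represented by the type of integer vectors indexed by a finite type
  with d elements; the standard generators are the vectors \<open>axis i 1\<close>.  The distance from
  the origin in the Cayley graph is the l1 norm.
\<close>

definition l1 :: "int ^ 'd::finite \<Rightarrow> int" where
  "l1 v = (\<Sum>i\<in>UNIV. \<bar>v $ i\<bar>)"

definition gball :: "nat \<Rightarrow> (int ^ 'd::finite) set" where
  "gball r = {u. l1 u \<le> int r}"

definition torus :: "nat ^ 'd::finite \<Rightarrow> (int ^ 'd) set" where
  "torus N = {v. \<forall>i. 0 \<le> v $ i \<and> v $ i < int (N $ i)}"

definition tshift :: "nat ^ 'd::finite \<Rightarrow> int ^ 'd \<Rightarrow> int ^ 'd \<Rightarrow> int ^ 'd" where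
  "tshift N v u = (\<chi> i. (v $ i + u $ i) mod int (N $ i))"

text \<open>
  The radius r balls of the torus are isomorphic, as graphs with edges oriented and labelled by the
  generators, to the radius r ball of the infinite grid: at every v, the map
  \<open>tshift N v\<close> is injective on \<open>gball r\<close> and reflects the labelled oriented
  edges (it always preserves them, and its image is the ball around v).
\<close>

definition grid_like :: "nat ^ 'd::finite \<Rightarrow> nat \<Rightarrow> bool" where
  "grid_like N r \<longleftrightarrow> (\<forall>v\<in>torus N. inj_on (tshift N v) (gball r) \<and>
     (\<forall>x\<in>gball r. \<forall>y\<in>gball r. \<forall>i.
        tshift N v y = tshift N (tshift N v x) (axis i 1) \<longrightarrow> y = x + axis i 1))"

text \<open>
  As isomorphisms preserve the edge labels, a rooted labelled ball of radius r is the same as an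
  extensional function on \<open>gball r\<close>, the root being at the origin.
\<close>

definition grid_view :: "(int ^ 'd::finite \<Rightarrow> 'a) \<Rightarrow> nat \<Rightarrow> int ^ 'd \<Rightarrow> (int ^ 'd \<Rightarrow> 'a)" where
  "grid_view \<omega> r v = restrict (\<lambda>u. \<omega> (v + u)) (gball r)"

definition torus_view ::
  "nat ^ 'd::finite \<Rightarrow> (int ^ 'd \<Rightarrow> 'a) \<Rightarrow> nat \<Rightarrow> int ^ 'd \<Rightarrow> (int ^ 'd \<Rightarrow> 'a)" where
  "torus_view N \<omega> r v = restrict (\<lambda>u. \<omega> (tshift N v u)) (gball r)"


section \<open>Problems without inputs\<close>

text \<open>
  A problem is given by its output labels and its valid solutions on the infinite grid and on each
  torus.  That the matching problem below is locally checkable, with finitely many labels, is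
  shown at the end.
\<close>

record ('d, 'o) grid_problem =
  out_labels :: "'o set"
  grid_valid :: "(int ^ 'd::finite \<Rightarrow> 'o) \<Rightarrow> bool"
  torus_valid :: "nat ^ 'd \<Rightarrow> (int ^ 'd \<Rightarrow> 'o) \<Rightarrow> bool"


section \<open>Perfect matchings\<close>

definition perfect_matching :: "'v set \<Rightarrow> 'v set set \<Rightarrow> 'v set set \<Rightarrow> bool" where
  "perfect_matching V E M \<longleftrightarrow> M \<subseteq> E \<and> (\<forall>v\<in>V. \<exists>!e. e \<in> M \<and> v \<in> e)"

definition box_edges :: "(int ^ 'd::finite) set set" where
  "box_edges = {{u, v} | u v. u \<noteq> v \<and> l1 (u - v) \<le> 2}"

definition torus_box_edges :: "nat ^ 'd::finite \<Rightarrow> (int ^ 'd) set set" where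
  "torus_box_edges N = {{u, v} | u v. u \<in> torus N \<and> v \<in> torus N \<and> u \<noteq> v \<and>
     (\<exists>\<delta>. l1 \<delta> \<le> 2 \<and> v = tshift N u \<delta>)}"

definition box_vectors :: "(int ^ 'd::finite) set" where
  "box_vectors = {\<delta>. \<delta> \<noteq> 0 \<and> l1 \<delta> \<le> 2}"

text \<open>Every vertex outputs the difference vector to the vertex it is matched with.\<close>

definition PM_box :: "('d::finite, int ^ 'd) grid_problem" where
  "PM_box = \<lparr>
     out_labels = box_vectors,
     grid_valid = (\<lambda>\<sigma>. \<exists>M. perfect_matching UNIV box_edges M \<and>
        (\<forall>v. \<sigma> v \<in> box_vectors \<and> {v, v + \<sigma> v} \<in> M)),
     torus_valid = (\<lambda>N \<sigma>. \<exists>M. perfect_matching (torus N) (torus_box_edges N) M \<and>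
        (\<forall>v\<in>torus N. \<sigma> v \<in> box_vectors \<and> {v, tshift N v (\<sigma> v)} \<in> M)) \<rparr>"


section \<open>Deterministic local algorithms\<close>

definition log_star :: "real \<Rightarrow> nat" where
  "log_star x = (LEAST k. (log 2 ^^ k) x \<le> 1)"

text \<open>
  The parameters a, b are the constants in the bound on the side lengths (of order the d-th root of
  the number n of vertices), and k is the exponent in the bound on the identifiers.
  Output is required to be valid on all sufficiently large tori whose balls of the explored radius
  look like balls of the grid.
\<close>

definition admissible_torus :: "real \<Rightarrow> real \<Rightarrow> nat ^ 'd::finite \<Rightarrow> bool" where
  "admissible_torus a b N \<longleftrightarrow> (\<forall>i.
     a * root CARD('d) (real (card (torus N))) \<le> real (N $ i) \<and>
     real (N $ i) \<le> b * root CARD('d) (real (card (torus N))))"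

definition identifiers :: "nat \<Rightarrow> nat ^ 'd::finite \<Rightarrow> (int ^ 'd \<Rightarrow> nat) \<Rightarrow> bool" where
  "identifiers k N \<iota> \<longleftrightarrow> inj_on \<iota> (torus N) \<and> \<iota> ` torus N \<subseteq> {1..card (torus N) ^ k}"

definition local_solves :: "real \<Rightarrow> real \<Rightarrow> nat \<Rightarrow> (nat \<Rightarrow> nat) \<Rightarrow>
    (nat \<Rightarrow> (int ^ 'd::finite \<Rightarrow> nat) \<Rightarrow> 'o) \<Rightarrow> ('d, 'o) grid_problem \<Rightarrow> bool" where
  "local_solves a b k f \<A> P \<longleftrightarrow> (\<exists>n\<^sub>0. \<forall>N \<iota>. (let n = card (torus N) in
     n\<^sub>0 \<le> n \<longrightarrow> admissible_torus a b N \<longrightarrow> grid_like N (f n) \<longrightarrow> identifiers k N \<iota> \<longrightarrow>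
     torus_valid P N (\<lambda>v. \<A> n (torus_view N \<iota> (f n) v))))"

definition LOCAL :: "real \<Rightarrow> real \<Rightarrow> nat \<Rightarrow> (nat \<Rightarrow> real) set \<Rightarrow> ('d::finite, 'o) grid_problem set" where
  "LOCAL a b k F = {P. \<exists>f \<A>. (\<lambda>n. real (f n)) \<in> F \<and> local_solves a b k f \<A> P}"


section \<open>Uniform local algorithms\<close>

definition unit_uniform :: "real measure" where
  "unit_uniform = restrict_space lborel {0..1}"

definition label_measure :: "(int ^ 'd::finite \<Rightarrow> real) measure" where
  "label_measure = PiM UNIV (\<lambda>_. unit_uniform)"

definition ball_space :: "nat \<Rightarrow> (int ^ 'd::finite \<Rightarrow> real) measure" where
  "ball_space r = PiM (gball r) (\<lambda>_. unit_uniform)"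

text \<open>
  In a uniform local algorithm, \<open>\<C> r\<close> consists of the members of radius r of the
  collection of labelled balls, and \<open>f r\<close> is the output function on these.
  Measurability of the partial function f includes that of its domain, so the coding radius is a random variable.
\<close>

definition uniform_alg :: "'o set \<Rightarrow> (nat \<Rightarrow> (int ^ 'd::finite \<Rightarrow> real) set) \<Rightarrow>
    (nat \<Rightarrow> (int ^ 'd \<Rightarrow> real) \<Rightarrow> 'o) \<Rightarrow> bool" where
  "uniform_alg \<Sigma> \<C> f \<longleftrightarrow> (\<forall>r. \<C> r \<in> sets (ball_space r) \<and>
     f r \<in> measurable (restrict_space (ball_space r) (\<C> r)) (count_space \<Sigma>))"

text \<open>The radius is infinite if the exploration never stops.\<close>

definition coding_radius :: "(nat \<Rightarrow> (int ^ 'd::finite \<Rightarrow> real) set) \<Rightarrow>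
    (int ^ 'd \<Rightarrow> real) \<Rightarrow> int ^ 'd \<Rightarrow> enat" where
  "coding_radius \<C> \<omega> v = (INF r\<in>{r. grid_view \<omega> r v \<in> \<C> r}. enat r)"

definition uniform_output :: "(nat \<Rightarrow> (int ^ 'd::finite \<Rightarrow> real) set) \<Rightarrow>
    (nat \<Rightarrow> (int ^ 'd \<Rightarrow> real) \<Rightarrow> 'o) \<Rightarrow> (int ^ 'd \<Rightarrow> real) \<Rightarrow> int ^ 'd \<Rightarrow> 'o" where
  "uniform_output \<C> f \<omega> v =
     (let r = the_enat (coding_radius \<C> \<omega> v) in f r (grid_view \<omega> r v))"

definition uniform_solves :: "(nat \<Rightarrow> (int ^ 'd::finite \<Rightarrow> real) set) \<Rightarrow>
    (nat \<Rightarrow> (int ^ 'd \<Rightarrow> real) \<Rightarrow> 'o) \<Rightarrow> ('d, 'o) grid_problem \<Rightarrow> bool" where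
  "uniform_solves \<C> f P \<longleftrightarrow> (AE \<omega> in label_measure.
     (\<forall>v. coding_radius \<C> \<omega> v < \<infinity>) \<and> grid_valid P (uniform_output \<C> f \<omega>))"

text \<open>The law of the coding radius is the same at all vertices, so the origin is used.\<close>

definition uniform_complexity ::
  "(nat \<Rightarrow> (int ^ 'd::finite \<Rightarrow> real) set) \<Rightarrow> (real \<Rightarrow> real) \<Rightarrow> bool" where
  "uniform_complexity \<C> t \<longleftrightarrow> (\<forall>\<^sub>F \<epsilon> in at_right 0.
     measure label_measure
       {\<omega> \<in> space label_measure. ereal_of_enat (coding_radius \<C> \<omega> 0) > ereal (t \<epsilon>)} \<le> \<epsilon>)"

definition ULOCAL :: "(real \<Rightarrow> real) set \<Rightarrow> ('d::finite, 'o) grid_problem set" where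
  "ULOCAL F = {P. \<exists>t \<C> f. t \<in> F \<and> uniform_alg (out_labels P) \<C> f \<and>
     uniform_complexity \<C> t \<and> uniform_solves \<C> f P}"


section \<open>The matching problem is locally checkable\<close>

lemma l1_uminus: "l1 (- v) = l1 v"
  by (simp add: l1_def)

lemma abs_le_l1: "\<bar>v $ i\<bar> \<le> l1 v"
  unfolding l1_def by (rule member_le_sum) auto

lemma finite_box_vectors: "finite (box_vectors :: (int ^ 'd::finite) set)"
proof -
  have "(box_vectors :: (int ^ 'd) set) \<subseteq> vec_lambda ` (UNIV \<rightarrow>\<^sub>E {-2..2})"
  proof
    fix v :: "int ^ 'd" assume "v \<in> box_vectors"
    then have "l1 v \<le> 2" by (simp add: box_vectors_def)
    then have "\<bar>v $ i\<bar> \<le> 2" for i using abs_le_l1[of v i] by linarith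
    then have "($) v \<in> UNIV \<rightarrow>\<^sub>E {-2..2}" by (auto simp: abs_le_iff minus_le_iff)
    moreover have "v = vec_lambda (($) v)" by simp
    ultimately show "v \<in> vec_lambda ` (UNIV \<rightarrow>\<^sub>E {-2..2})" by blast
  qed
  then show ?thesis by (rule finite_subset) (intro finite_imageI finite_PiE, auto)
qed

lemma PM_box_grid_valid_iff:
  "grid_valid PM_box \<sigma> \<longleftrightarrow>
     (\<forall>v. \<sigma> v \<in> out_labels PM_box \<and> \<sigma> (v + \<sigma> v) = - \<sigma> v)"
proof
  assume "grid_valid PM_box \<sigma>"
  then obtain M where M: "perfect_matching UNIV box_edges M"
    and s: "\<And>v. \<sigma> v \<in> box_vectors" "\<And>v. {v, v + \<sigma> v} \<in> M"
    by (auto simp: PM_box_def)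
  have "\<sigma> (v + \<sigma> v) = - \<sigma> v" for v
  proof -
    let ?w = "v + \<sigma> v"
    have "{v, ?w} = {?w, ?w + \<sigma> ?w}"
      using M s(2)[of v] s(2)[of ?w] unfolding perfect_matching_def by blast
    moreover have "v \<noteq> ?w" using s(1)[of v] by (simp add: box_vectors_def)
    ultimately have "v = ?w + \<sigma> ?w" by (metis doubleton_eq_iff)
    then show ?thesis by (simp add: add.assoc eq_neg_iff_add_eq_0 add.commute)
  qed
  then show "\<forall>v. \<sigma> v \<in> out_labels PM_box \<and> \<sigma> (v + \<sigma> v) = - \<sigma> v"
    using s by (simp add: PM_box_def)
next
  assume "\<forall>v. \<sigma> v \<in> out_labels PM_box \<and> \<sigma> (v + \<sigma> v) = - \<sigma> v"
  then have s: "\<And>v. \<sigma> v \<in> box_vectors" "\<And>v. \<sigma> (v + \<sigma> v) = - \<sigma> v"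
    by (auto simp: PM_box_def)
  let ?M = "range (\<lambda>v. {v, v + \<sigma> v})"
  have "?M \<subseteq> box_edges"
  proof clarify
    fix v
    have "v \<noteq> v + \<sigma> v" "l1 (v - (v + \<sigma> v)) \<le> 2"
      using s(1)[of v] by (auto simp: box_vectors_def l1_uminus)
    then show "{v, v + \<sigma> v} \<in> box_edges" unfolding box_edges_def by blast
  qed
  moreover have "\<exists>!e. e \<in> ?M \<and> v \<in> e" for v
  proof (rule ex1I[of _ "{v, v + \<sigma> v}"])
    fix e assume "e \<in> ?M \<and> v \<in> e"
    then obtain u where u: "e = {u, u + \<sigma> u}" "v = u \<or> v = u + \<sigma> u" by auto
    then show "e = {v, v + \<sigma> v}" using s(2)[of u] by auto
  qed auto
  ultimately have "perfect_matching UNIV box_edges ?M"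
    by (simp add: perfect_matching_def)
  then show "grid_valid PM_box \<sigma>" using s(1) by (auto simp: PM_box_def)
qed

lemma tshift_in_torus:
  assumes "v \<in> torus N"
  shows "tshift N v u \<in> torus N"
proof -
  have "0 < int (N $ i)" for i using assms by (auto simp: torus_def dest: spec[of _ i])
  then show ?thesis by (simp add: torus_def tshift_def)
qed

lemma tshift_tshift: "tshift N (tshift N v x) y = tshift N v (x + y)"
  by (simp add: tshift_def vec_eq_iff mod_add_left_eq add.assoc)

lemma tshift_zero: "v \<in> torus N \<Longrightarrow> tshift N v 0 = v"
  by (simp add: tshift_def torus_def vec_eq_iff)

lemma tshift_small_inj:
  assumes "\<forall>i. 5 \<le> N $ i" "tshift N v x = tshift N v y" "l1 x \<le> 2" "l1 y \<le> 2"
  shows "x = y"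
proof -
  have "x $ i = y $ i" for i
  proof -
    have "(v $ i + x $ i) mod int (N $ i) = (v $ i + y $ i) mod int (N $ i)"
      using assms(2) by (simp add: tshift_def vec_eq_iff)
    then have "int (N $ i) dvd x $ i - y $ i"
      by (metis add_diff_cancel_left mod_eq_dvd_iff)
    moreover have "\<bar>x $ i - y $ i\<bar> < int (N $ i)"
      using abs_le_l1[of x i] abs_le_l1[of y i] assms(1)[rule_format, of i] assms(3,4) by linarith
    ultimately show ?thesis using zdvd_not_zless[of "\<bar>x $ i - y $ i\<bar>"] by fastforce
  qed
  then show ?thesis by (simp add: vec_eq_iff)
qed

lemma PM_box_torus_valid_iff:
  assumes N: "\<forall>i. 5 \<le> N $ i"
  shows "torus_valid PM_box N \<sigma> \<longleftrightarrow>
     (\<forall>v\<in>torus N. \<sigma> v \<in> out_labels PM_box \<and> \<sigma> (tshift N v (\<sigma> v)) = - \<sigma> v)"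
proof
  have ne: "tshift N v x \<noteq> v" if "v \<in> torus N" "x \<in> box_vectors" for v x
    using tshift_small_inj[OF N, of v x 0] that tshift_zero[of v N]
    by (auto simp: box_vectors_def l1_def)
  {
    assume "torus_valid PM_box N \<sigma>"
    then obtain M where M: "perfect_matching (torus N) (torus_box_edges N) M"
      and s: "\<And>v. v \<in> torus N \<Longrightarrow> \<sigma> v \<in> box_vectors"
             "\<And>v. v \<in> torus N \<Longrightarrow> {v, tshift N v (\<sigma> v)} \<in> M"
      by (auto simp: PM_box_def)
    have "\<sigma> (tshift N v (\<sigma> v)) = - \<sigma> v" if v: "v \<in> torus N" for v
    proof -
      let ?w = "tshift N v (\<sigma> v)"
      have w: "?w \<in> torus N" using v by (rule tshift_in_torus)
      have "{v, ?w} = {?w, tshift N ?w (\<sigma> ?w)}"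
        using M s(2)[OF v] s(2)[OF w] w unfolding perfect_matching_def by blast
      then have "tshift N ?w (\<sigma> ?w) = v"
        using ne[OF v s(1)[OF v]] by (metis doubleton_eq_iff)
      moreover have "tshift N ?w (- \<sigma> v) = v"
        by (simp add: tshift_tshift tshift_zero v)
      ultimately show ?thesis
        using tshift_small_inj[OF N, of ?w "\<sigma> ?w" "- \<sigma> v"] s(1)[OF v] s(1)[OF w]
        by (simp add: box_vectors_def l1_uminus)
    qed
    then show "\<forall>v\<in>torus N. \<sigma> v \<in> out_labels PM_box \<and> \<sigma> (tshift N v (\<sigma> v)) = - \<sigma> v"
      using s by (simp add: PM_box_def)
  next
    assume "\<forall>v\<in>torus N. \<sigma> v \<in> out_labels PM_box \<and> \<sigma> (tshift N v (\<sigma> v)) = - \<sigma> v"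
    then have s: "\<And>v. v \<in> torus N \<Longrightarrow> \<sigma> v \<in> box_vectors"
        "\<And>v. v \<in> torus N \<Longrightarrow> \<sigma> (tshift N v (\<sigma> v)) = - \<sigma> v"
      by (auto simp: PM_box_def)
    let ?M = "(\<lambda>v. {v, tshift N v (\<sigma> v)}) ` torus N"
    have "?M \<subseteq> torus_box_edges N"
    proof clarify
      fix v assume v: "v \<in> torus N"
      have "v \<noteq> tshift N v (\<sigma> v)" "l1 (\<sigma> v) \<le> 2"
        using ne[OF v s(1)[OF v]] s(1)[OF v] by (auto simp: box_vectors_def)
      then show "{v, tshift N v (\<sigma> v)} \<in> torus_box_edges N"
        using v tshift_in_torus[OF v] unfolding torus_box_edges_def by blast
    qed
    moreover have "\<exists>!e. e \<in> ?M \<and> v \<in> e" if v: "v \<in> torus N" for v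
    proof (rule ex1I[of _ "{v, tshift N v (\<sigma> v)}"])
      fix e assume "e \<in> ?M \<and> v \<in> e"
      then obtain u where u: "u \<in> torus N" "e = {u, tshift N u (\<sigma> u)}"
          "v = u \<or> v = tshift N u (\<sigma> u)" by auto
      have "tshift N (tshift N u (\<sigma> u)) (- \<sigma> u) = u"
        by (simp add: tshift_tshift tshift_zero u)
      then show "e = {v, tshift N v (\<sigma> v)}" using u s(2)[OF u(1)] by auto
    qed (use v in auto)
    ultimately have "perfect_matching (torus N) (torus_box_edges N) ?M"
      by (simp add: perfect_matching_def)
    then show "torus_valid PM_box N \<sigma>" using s(1) by (auto simp: PM_box_def)
  }
qed

end

theory Submission
  imports Defs "HOL-Real_Asymp.Real_Asymp"
begin

text \<open>
  A perfect matching pairs up the vertices, so a torus with all sides of the same odd length has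
  none, and \<open>log_star\<close> grows slowly enough that the balls explored in a large cubical torus look
  like grid balls.

  For uniform algorithms, the obstruction already lives on the boundary of boxes.  In a
  perfect matching of the grid, the number of vertices of a box of odd side L matched out of the box
  is odd.  Subdivide the torus of side 3L into \<open>3 ^ d\<close> such boxes.  If the coding radii near
  the box boundaries are at most L - 2, then the algorithm can be run there as if each box, with
  its surroundings, were in the infinite grid, and the matching edges leaving the boxes are
  seen consistently from both sides.  Each box has an odd number of outgoing vertices, so the total is
  odd; but these vertices are paired with each other.  Hence one of the order of
  \<open>L ^ (d - 1)\<close> boundary vertices always has a coding radius above L - 2, which contradicts the
  union bound when the tail of the coding radius is too small.
\<close>

subsection \<open>Parity and cubical tori\<close>

text \<open>The orbits \<open>{x, h x}\<close> of a fixed-point-free involution partition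
  \<open>S\<close> into two-element blocks.\<close>

lemma even_card_if_involution:
  assumes "finite S" and "\<And>x. x \<in> S \<Longrightarrow> h x \<in> S \<and> h x \<noteq> x \<and> h (h x) = x"
  shows "even (card S)"
proof -
  let ?C = "(\<lambda>x. {x, h x}) ` S"
  have U: "\<Union> ?C = S" using assms(2) by auto
  have "2 * card ?C = card (\<Union> ?C)"
  proof (rule card_partition)
    show "finite ?C" "finite (\<Union> ?C)" using assms(1) U by auto
    show "card c = 2" if "c \<in> ?C" for c
      using that assms(2) by (fastforce simp: card_2_iff)
    have orbit: "c = {z, h z}" if "c \<in> ?C" "z \<in> c" for c z
      using that assms(2) by auto
    show "c \<inter> c' = {}" if "c \<in> ?C" "c' \<in> ?C" "c \<noteq> c'" for c c'
    proof (rule ccontr)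
      assume "c \<inter> c' \<noteq> {}"
      then obtain z where "z \<in> c" "z \<in> c'" by blast
      then show False using orbit[of c z] orbit[of c' z] that by simp
    qed
  qed
  then show ?thesis using U by (metis dvd_triv_left)
qed

abbreviation cube_dims :: "nat \<Rightarrow> nat ^ 'd::finite" where
  "cube_dims m \<equiv> (\<chi> i. m)"

abbreviation cube :: "nat \<Rightarrow> (int ^ 'd::finite) set" where
  "cube m \<equiv> torus (cube_dims m)"

lemma vec_box_eq_image:
  "{x :: 'a ^ 'd::finite. \<forall>i. x $ i \<in> A i} = vec_lambda ` (PiE UNIV A)"
proof
  show "{x :: 'a ^ 'd. \<forall>i. x $ i \<in> A i} \<subseteq> vec_lambda ` (PiE UNIV A)"
  proof
    fix x :: "'a ^ 'd" assume "x \<in> {x. \<forall>i. x $ i \<in> A i}"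
    then have "($) x \<in> PiE UNIV A" by auto
    then show "x \<in> vec_lambda ` (PiE UNIV A)" by (metis image_eqI vec_nth_inverse)
  qed
qed auto

lemma card_vec_box:
  "card {x :: 'a ^ 'd::finite. \<forall>i. x $ i \<in> A i} = (\<Prod>i\<in>UNIV. card (A i))"
  unfolding vec_box_eq_image
  by (subst card_image) (auto intro!: inj_onI simp: card_PiE vec_lambda_inject)

lemma finite_vec_box:
  assumes "\<And>i. finite (A i)"
  shows "finite {x :: 'a ^ 'd::finite. \<forall>i. x $ i \<in> A i}"
  unfolding vec_box_eq_image by (intro finite_imageI finite_PiE) (auto simp: assms)

lemma torus_eq_vec_box: "torus N = {x. \<forall>i. x $ i \<in> {0..<int (N $ i)}}"
  by (auto simp: torus_def)

lemma finite_torus: "finite (torus N)"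
  unfolding torus_eq_vec_box by (rule finite_vec_box) simp

lemma card_cube: "card (cube m :: (int ^ 'd::finite) set) = m ^ CARD('d)"
  unfolding torus_eq_vec_box by (subst card_vec_box) simp

lemma tshift_eq_iff:
  "tshift N v x = tshift N w y \<longleftrightarrow> (\<forall>i. int (N $ i) dvd (v $ i + x $ i) - (w $ i + y $ i))"
  by (simp add: tshift_def vec_eq_iff mod_eq_dvd_iff)

lemma eq_if_dvd_diff:
  fixes x y m :: int
  assumes "m dvd x - y" "\<bar>x - y\<bar> < m"
  shows "x = y"
  using assms zdvd_not_zless[of "\<bar>x - y\<bar>" m] by fastforce

subsection \<open>Deterministic algorithms\<close>

text \<open>Since \<open>n + 2 \<le> 2 ^ (n + 1)\<close>, each application of \<open>log 2\<close>
  to a value above 1 lowers the bound by at least one.\<close>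

lemma log_iterate_le_1:
  assumes "y \<le> real n + 1"
  shows "\<exists>k\<le>n. (log 2 ^^ k) y \<le> 1"
  using assms
proof (induction n arbitrary: y)
  case (Suc n)
  show ?case
  proof (cases "y \<le> 1")
    case False
    have "Suc (Suc n) \<le> 2 ^ Suc n" by (induction n) auto
    then have "real (Suc (Suc n)) \<le> 2 ^ Suc n" by (metis of_nat_le_iff of_nat_numeral of_nat_power)
    then have "y \<le> 2 ^ Suc n" using Suc.prems by simp
    then have "log 2 y \<le> log 2 (2 ^ Suc n)" using False by (subst log_le_cancel_iff) auto
    then have "log 2 y \<le> real n + 1" by (simp add: log_nat_power del: power_Suc)
    then obtain k where "k \<le> n" "(log 2 ^^ k) (log 2 y) \<le> 1" using Suc.IH by blast
    then show ?thesis by (intro exI[of _ "Suc k"]) (simp add: funpow_swap1)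
  qed (auto intro: exI[of _ 0])
qed auto

text \<open>A crude logarithmic bound is enough, as the explored radius only has to stay below half
  the side of a cube. The summand 2 accounts for the first logarithm and for rounding up.\<close>

lemma log_star_le:
  assumes "1 \<le> x"
  shows "real (log_star x) \<le> log 2 x + 2"
proof -
  define n where "n = nat \<lceil>log 2 x\<rceil>"
  have l: "0 \<le> log 2 x" using assms by simp
  have "log 2 x \<le> real n + 1" unfolding n_def using l by linarith
  then obtain k where k: "k \<le> n" "(log 2 ^^ k) (log 2 x) \<le> 1" using log_iterate_le_1 by blast
  then have "(log 2 ^^ Suc k) x \<le> 1" by (simp add: funpow_swap1)
  then have "log_star x \<le> Suc k" unfolding log_star_def by (rule Least_le)
  moreover have "real n \<le> log 2 x + 1" unfolding n_def using l by linarith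
  ultimately show ?thesis using k(1) by linarith
qed

text \<open>A point of the ball and another one moved by at most one edge differ by at most
  \<open>2 * r + 1 < m\<close> in each coordinate, so congruence modulo \<open>m\<close> is
  equality. The displacement \<open>e = 0\<close> gives injectivity, \<open>e = axis i 1\<close> the
  reflection of edges.\<close>

lemma grid_like_cube:
  assumes "2 * r + 1 < m"
  shows "grid_like (cube_dims m :: nat ^ 'd::finite) r"
proof -
  have small: "x = y + e"
    if "tshift (cube_dims m) v x = tshift (cube_dims m) v (y + e)" "x \<in> gball r" "y \<in> gball r"
      "l1 e \<le> 1" for v x y e :: "int ^ 'd"
  proof -
    have "x $ i = (y + e) $ i" for i
    proof (rule eq_if_dvd_diff)
      show "int m dvd x $ i - (y + e) $ i"
        using that(1) unfolding tshift_eq_iff by (auto dest!: spec[of _ i])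
      show "\<bar>x $ i - (y + e) $ i\<bar> < int m"
        using abs_le_l1[of x i] abs_le_l1[of y i] abs_le_l1[of e i] that assms
        by (auto simp: gball_def)
    qed
    then show ?thesis by (simp add: vec_eq_iff)
  qed
  have "l1 (axis i 1 :: int ^ 'd) \<le> 1" for i
    by (simp add: l1_def axis_def if_distrib[of abs] cong: if_cong)
  moreover have "l1 (0 :: int ^ 'd) \<le> 1" by (simp add: l1_def)
  ultimately show ?thesis
    unfolding grid_like_def inj_on_def tshift_tshift
    using small[where e = 0] small[where e = "axis i 1" for i] by (metis add.right_neutral)
qed

text \<open>Passing to the partner would be a fixed-point-free involution on the odd number
  \<open>m ^ CARD('d)\<close> of vertices. The bound \<open>5 \<le> m\<close> keeps short vectors
  distinct modulo \<open>m\<close>.\<close>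

lemma not_torus_valid_PM_box_cube:
  fixes \<sigma> :: "int ^ 'd::finite \<Rightarrow> int ^ 'd"
  assumes "odd m" "5 \<le> m"
  shows "\<not> torus_valid PM_box (cube_dims m) \<sigma>"
proof
  let ?N = "cube_dims m :: nat ^ 'd"
  assume "torus_valid PM_box ?N \<sigma>"
  then have s: "\<And>v. v \<in> torus ?N \<Longrightarrow> \<sigma> v \<in> box_vectors"
      "\<And>v. v \<in> torus ?N \<Longrightarrow> \<sigma> (tshift ?N v (\<sigma> v)) = - \<sigma> v"
    using assms(2) by (auto simp: PM_box_torus_valid_iff) (auto simp: PM_box_def)
  have "even (card (torus ?N))"
  proof (rule even_card_if_involution[OF finite_torus])
    fix v assume v: "v \<in> torus ?N"
    have "tshift ?N v (\<sigma> v) \<noteq> tshift ?N v 0"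
      using tshift_small_inj[of ?N v "\<sigma> v" 0] s(1)[OF v] assms(2)
      by (auto simp: box_vectors_def l1_def)
    then show "tshift ?N v (\<sigma> v) \<in> torus ?N \<and> tshift ?N v (\<sigma> v) \<noteq> v \<and>
        tshift ?N (tshift ?N v (\<sigma> v)) (\<sigma> (tshift ?N v (\<sigma> v))) = v"
      using v s(2)[OF v] by (simp add: tshift_in_torus tshift_tshift tshift_zero)
  qed
  then show False using assms by (simp add: card_cube)
qed

text \<open>It suffices to find one large odd cube on which the algorithm is required to succeed.
  The bounds on \<open>a\<close> and \<open>b\<close> admit cubes, and \<open>1 \<le> k\<close>
  leaves room for \<open>n\<close> distinct identifiers.\<close>

theorem PM_box_notin_LOCAL:
  fixes a b :: real and k :: nat
  assumes "a \<le> 1" and "1 \<le> b" and "1 \<le> k"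
  shows "(PM_box :: ('d::finite, int ^ 'd) grid_problem) \<notin> LOCAL a b k (O(\<lambda>n. real (log_star (real n))))"
proof
  let ?d = "CARD('d)"
  assume "(PM_box :: ('d, int ^ 'd) grid_problem) \<in> LOCAL a b k (O(\<lambda>n. real (log_star (real n))))"
  then obtain f \<A> where f: "(\<lambda>n. real (f n)) \<in> O(\<lambda>n. real (log_star (real n)))"
    and solves: "local_solves a b k f \<A> (PM_box :: ('d, int ^ 'd) grid_problem)"
    by (auto simp: LOCAL_def)
  obtain c where c: "c > 0" "\<forall>\<^sub>F n in at_top. real (f n) \<le> c * real (log_star (real n))"
    using f by (elim landau_o.bigE) auto
  obtain n\<^sub>0 where n0: "\<And>N \<iota>. n\<^sub>0 \<le> card (torus N) \<Longrightarrow> admissible_torus a b N \<Longrightarrow>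
      grid_like N (f (card (torus N))) \<Longrightarrow> identifiers k N \<iota> \<Longrightarrow>
      torus_valid (PM_box :: ('d, int ^ 'd) grid_problem) N
        (\<lambda>v. \<A> (card (torus N)) (torus_view N \<iota> (f (card (torus N))) v))"
    using solves by (auto simp: local_solves_def Let_def)
  have lim: "filterlim (\<lambda>m::nat. m ^ ?d) at_top at_top"
    by (rule filterlim_at_top_mono[OF filterlim_ident])
      (auto intro!: always_eventually self_le_power eventually_at_top_linorderI[of 1])
  \<comment> \<open>With \<open>n = m ^ CARD('d)\<close>, \<open>log_star_le\<close> bounds
    \<open>log_star n\<close> by the inner factor, so this yields \<open>2 * f n + 1 < m\<close> as
    needed for \<open>grid_like_cube\<close>.\<close>
  have "\<forall>\<^sub>F m in at_top. 2 * (c * (real ?d * log 2 (real m) + 2)) + 1 < real m"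
    using c(1) by real_asymp
  moreover have "\<forall>\<^sub>F m in at_top. real (f (m ^ ?d)) \<le> c * real (log_star (real (m ^ ?d)))"
    using lim c(2) by (rule eventually_compose_filterlim[rotated])
  moreover have "\<forall>\<^sub>F m in at_top. n\<^sub>0 \<le> m ^ ?d"
    using lim by (simp add: filterlim_at_top)
  ultimately have "\<forall>\<^sub>F m in at_top. 2 * (c * (real ?d * log 2 (real m) + 2)) + 1 < real m \<and>
      real (f (m ^ ?d)) \<le> c * real (log_star (real (m ^ ?d))) \<and> n\<^sub>0 \<le> m ^ ?d"
    by (intro eventually_conj)
  then obtain M where M: "\<And>m. m \<ge> M \<Longrightarrow> 2 * (c * (real ?d * log 2 (real m) + 2)) + 1 < real m \<and>
      real (f (m ^ ?d)) \<le> c * real (log_star (real (m ^ ?d))) \<and> n\<^sub>0 \<le> m ^ ?d"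
    by (auto simp: eventually_at_top_linorder)
  \<comment> \<open>Odd, at least 5, and beyond the threshold \<open>M\<close>.\<close>
  define m where "m = 2 * M + 5"
  let ?N = "cube_dims m :: nat ^ 'd" and ?n = "m ^ ?d"
  have m: "odd m" "5 \<le> m" "m \<ge> M" by (auto simp: m_def)
  have "real (log_star (real ?n)) \<le> log 2 (real ?n) + 2"
    by (rule log_star_le) (use m in simp)
  also have "log 2 (real ?n) = real ?d * log 2 (real m)"
    using m by (simp add: log_nat_power)
  finally have "c * real (log_star (real ?n)) \<le> c * (real ?d * log 2 (real m) + 2)"
    using c(1) by (intro mult_left_mono) auto
  then have "2 * real (f ?n) + 1 < real m" using M[OF m(3)] by linarith
  then have "grid_like ?N (f ?n)" by (intro grid_like_cube) linarith
  moreover have "admissible_torus a b ?N"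
  proof -
    have "root ?d (real ?n) = real m" by (simp add: real_root_power_cancel)
    then show ?thesis using assms(1,2) m(2)
      by (simp add: admissible_torus_def card_cube mult_le_cancel_right1 mult_le_cancel_right2)
  qed
  moreover obtain \<iota> where "bij_betw \<iota> (torus ?N) {1..?n}"
    using ex_bij_betw_finite_nat[OF finite_torus[of ?N]]
    by (metis card_atLeastAtMost card_cube diff_Suc_1 finite_atLeastAtMost finite_same_card_bij finite_torus)
  then have "identifiers k ?N \<iota>"
    using assms(3) m(2) self_le_power[of ?n k]
    by (auto simp: identifiers_def bij_betw_def card_cube)
  ultimately show False
    using n0[of ?N \<iota>] M[OF m(3)] not_torus_valid_PM_box_cube[OF m(1,2)] by (auto simp: card_cube)
qed

subsection \<open>Coding radii and reindexed labels\<close>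

lemma coding_radius_le_iff:
  "coding_radius \<C> \<omega> v \<le> enat r \<longleftrightarrow> (\<exists>s\<le>r. grid_view \<omega> s v \<in> \<C> s)"
proof
  assume l: "coding_radius \<C> \<omega> v \<le> enat r"
  show "\<exists>s\<le>r. grid_view \<omega> s v \<in> \<C> s"
  proof (rule ccontr)
    assume "\<not> ?thesis"
    then have "enat (Suc r) \<le> coding_radius \<C> \<omega> v"
      unfolding coding_radius_def by (intro INF_greatest) (auto simp: not_less_eq_eq)
    then have "enat (Suc r) \<le> enat r" using l by (rule order_trans)
    then show False by simp
  qed
next
  assume "\<exists>s\<le>r. grid_view \<omega> s v \<in> \<C> s"
  then obtain s where "s \<le> r" "grid_view \<omega> s v \<in> \<C> s" by blast
  then show "coding_radius \<C> \<omega> v \<le> enat r"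
    unfolding coding_radius_def by (intro INF_lower2[of s]) auto
qed

lemma ereal_coding_radius_le_iff:
  "ereal_of_enat (coding_radius \<C> \<omega> v) \<le> ereal t \<longleftrightarrow> (\<exists>s. real s \<le> t \<and> grid_view \<omega> s v \<in> \<C> s)"
proof
  assume t: "ereal_of_enat (coding_radius \<C> \<omega> v) \<le> ereal t"
  then obtain r where r: "coding_radius \<C> \<omega> v = enat r"
    by (cases "coding_radius \<C> \<omega> v") auto
  then obtain s where "s \<le> r" "grid_view \<omega> s v \<in> \<C> s"
    using coding_radius_le_iff[of \<C> \<omega> v r] by auto
  moreover have "real r \<le> t" using t r by simp
  ultimately show "\<exists>s. real s \<le> t \<and> grid_view \<omega> s v \<in> \<C> s"
    by (intro exI[of _ s]) linarith
next
  assume "\<exists>s. real s \<le> t \<and> grid_view \<omega> s v \<in> \<C> s"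
  then obtain s where s: "real s \<le> t" "grid_view \<omega> s v \<in> \<C> s" by blast
  then have "coding_radius \<C> \<omega> v \<le> enat s" using coding_radius_le_iff by blast
  then have "ereal_of_enat (coding_radius \<C> \<omega> v) \<le> ereal_of_enat (enat s)"
    by (simp only: ereal_of_enat_le_iff)
  also have "\<dots> \<le> ereal t" using s(1) by simp
  finally show "ereal_of_enat (coding_radius \<C> \<omega> v) \<le> ereal t" .
qed

text \<open>Agreement on the ball of radius \<open>r\<close> makes all views up to that radius
  equal, so both explorations stop at the same time. Roots and labellings may both differ, which
  allows comparing runs in different glued boxes.\<close>

lemma uniform_output_local:
  assumes r: "coding_radius \<C> \<omega> x \<le> enat r"
    and eq: "\<And>u. u \<in> gball r \<Longrightarrow> \<omega> (x + u) = \<omega>' (x' + u)"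
  shows "uniform_output \<C> f \<omega>' x' = uniform_output \<C> f \<omega> x"
proof -
  have gv: "grid_view \<omega> s x = grid_view \<omega>' s x'" if "s \<le> r" for s
    unfolding grid_view_def using that by (intro restrict_ext eq) (simp add: gball_def)
  have iff: "coding_radius \<C> \<omega> x \<le> enat s \<longleftrightarrow> coding_radius \<C> \<omega>' x' \<le> enat s" if "s \<le> r" for s
    unfolding coding_radius_le_iff using gv that by (metis order_trans)
  obtain a where a: "coding_radius \<C> \<omega> x = enat a" "a \<le> r"
    using enat_ile[OF r] r by auto
  then have "coding_radius \<C> \<omega>' x' \<le> enat a" using iff by auto
  moreover from enat_ile[OF this] obtain b where b: "coding_radius \<C> \<omega>' x' = enat b" by blast
  ultimately have "b \<le> a" by simp
  then have "coding_radius \<C> \<omega> x \<le> enat b" using iff[of b] a b by simp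
  then have "coding_radius \<C> \<omega>' x' = enat a" using \<open>b \<le> a\<close> a b by simp
  then show ?thesis using a gv by (simp add: uniform_output_def)
qed

section \<open>Invariance of the label law under injective relabelling\<close>

lemma prob_space_unit_uniform: "prob_space unit_uniform"
  unfolding unit_uniform_def by (rule prob_space_restrict_space) auto

lemma prob_space_label_measure: "prob_space label_measure"
  unfolding label_measure_def by (rule prob_space_PiM) (rule prob_space_unit_uniform)

lemma measurable_reindex: "(\<lambda>\<omega>. \<omega> \<circ> g) \<in> measurable label_measure label_measure"
proof -
  have "(\<lambda>\<omega>. restrict (\<lambda>x. \<omega> (g x)) UNIV) \<in> measurable label_measure label_measure"
    unfolding label_measure_def
    by (intro measurable_restrict measurable_component_singleton) auto
  then show ?thesis by (simp add: comp_def restrict_def)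
qed

text \<open>Independent uniform labels read along an injective map are again independent and
  uniform.\<close>

lemma distr_reindex:
  assumes "inj g"
  shows "distr label_measure label_measure (\<lambda>\<omega>. \<omega> \<circ> g) = label_measure"
proof -
  have "distr label_measure label_measure (\<lambda>\<omega>. restrict (\<lambda>x. \<omega> (g x)) UNIV) = label_measure"
    unfolding label_measure_def
    using distr_PiM_reindex[of UNIV "\<lambda>_. unit_uniform" g UNIV] prob_space_unit_uniform assms by auto
  then show ?thesis by (simp add: comp_def restrict_def)
qed

lemma AE_reindex:
  assumes "inj g" "AE \<omega> in label_measure. Q \<omega>"
  shows "AE \<omega> in label_measure. Q (\<omega> \<circ> g)"
  using assms(2) by (intro AE_distrD[OF measurable_reindex]) (simp only: distr_reindex[OF assms(1)])

lemma sets_grid_view: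
  assumes "\<C> s \<in> sets (ball_space s)"
  shows "{\<omega> \<in> space label_measure. grid_view \<omega> s v \<in> \<C> s} \<in> sets label_measure"
proof -
  have "(\<lambda>\<omega>. grid_view \<omega> s v) \<in> measurable label_measure (ball_space s)"
    unfolding grid_view_def label_measure_def ball_space_def
    by (intro measurable_restrict measurable_component_singleton) auto
  from measurable_sets[OF this assms] show ?thesis
    by (simp add: vimage_def Int_def conj_commute)
qed

lemma sets_coding_radius_greater:
  assumes "\<And>s. \<C> s \<in> sets (ball_space s)"
  shows "{\<omega> \<in> space label_measure. ereal_of_enat (coding_radius \<C> \<omega> v) > ereal t} \<in> sets label_measure"
proof -
  have "{\<omega> \<in> space label_measure. ereal_of_enat (coding_radius \<C> \<omega> v) > ereal t} =
      space label_measure -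
        (\<Union>s\<in>{s. real s \<le> t}. {\<omega> \<in> space label_measure. grid_view \<omega> s v \<in> \<C> s})"
    unfolding not_le[symmetric] ereal_coding_radius_le_iff by auto
  also have "\<dots> \<in> sets label_measure"
    by (intro sets.Diff sets.top sets.countable_UN'') (auto intro: sets_grid_view assms)
  finally show ?thesis .
qed

lemma coding_radius_reindex:
  "coding_radius \<C> (\<omega> \<circ> g) x = coding_radius \<C> (\<omega> \<circ> (g \<circ> (+) x)) 0"
  by (simp add: coding_radius_def grid_view_def)

text \<open>Translating the root from \<open>x\<close> to the origin is itself an injective
  relabelling, so it can be merged with \<open>g\<close> into a single one that preserves the
  law.\<close>

lemma measure_coding_radius_reindex:
  assumes "\<And>s. \<C> s \<in> sets (ball_space s)" and "inj g"
  shows "{\<omega> \<in> space label_measure. ereal_of_enat (coding_radius \<C> (\<omega> \<circ> g) x) > ereal t} \<in> sets label_measure"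
      (is "?A \<in> _")
    and "measure label_measure {\<omega> \<in> space label_measure. ereal_of_enat (coding_radius \<C> (\<omega> \<circ> g) x) > ereal t} =
      measure label_measure {\<omega> \<in> space label_measure. ereal_of_enat (coding_radius \<C> \<omega> 0) > ereal t}"
proof -
  let ?h = "g \<circ> (+) x"
  let ?E = "{\<omega> \<in> space label_measure. ereal_of_enat (coding_radius \<C> \<omega> 0) > ereal t}"
  have E: "?E \<in> sets label_measure" using sets_coding_radius_greater assms(1) .
  have inj: "inj ?h" using assms(2) by (intro inj_compose) auto
  have A: "?A = (\<lambda>\<omega>. \<omega> \<circ> ?h) -` ?E \<inter> space label_measure"
    unfolding coding_radius_reindex[of _ _ g]
    using measurable_space[OF measurable_reindex[of ?h]] by blast
  show "?A \<in> sets label_measure"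
    unfolding A using measurable_reindex E by (rule measurable_sets)
  have "measure label_measure ?E = measure (distr label_measure label_measure (\<lambda>\<omega>. \<omega> \<circ> ?h)) ?E"
    using distr_reindex[OF inj] by simp
  also have "\<dots> = measure label_measure ?A"
    unfolding A using measurable_reindex E by (rule measure_distr)
  finally show "measure label_measure ?A = measure label_measure ?E" by simp
qed

subsection \<open>Gluing boxes along their boundaries\<close>

text \<open>These are the lower corners of the boxes of side \<open>L\<close> tiling the torus of
  side \<open>3 * L\<close>. Three per direction make the number of boxes odd and leave room for a
  margin of width \<open>L\<close> around each box.\<close>

definition corners :: "nat \<Rightarrow> (int ^ 'd::finite) set" where
  "corners L = {p. \<forall>i. p $ i \<in> {0, int L, 2 * int L}}"

text \<open>Only these vertices of the box can be matched out of it, so only their coding radii need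
  control.\<close>

definition layer :: "nat \<Rightarrow> (int ^ 'd::finite) set" where
  "layer L = {x \<in> cube L. \<exists>\<delta>\<in>box_vectors. x + \<delta> \<notin> cube L}"

text \<open>
  The map \<open>glue L p\<close> copies the surroundings of the box at the corner p from the torus of
  side 3L.  Outside the window it only has to be injective, so that relabelling along it preserves
  the law of the labels; the values there avoid the torus.
\<close>

definition glue :: "nat \<Rightarrow> int ^ 'd::finite \<Rightarrow> int ^ 'd \<Rightarrow> int ^ 'd" where
  "glue L p x = (if \<forall>i. - int L \<le> x $ i \<and> x $ i < 2 * int L then tshift (cube_dims (3 * L)) p x
     else (\<chi> i. if x $ i \<ge> 0 then x $ i + 3 * int L else x $ i))"

lemma card_corners:
  assumes "L > 0"
  shows "finite (corners L :: (int ^ 'd::finite) set)"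
    and "card (corners L :: (int ^ 'd::finite) set) = 3 ^ CARD('d)"
  unfolding corners_def using assms
  by (auto simp: card_vec_box[where A = "\<lambda>_. {0, int L, 2 * int L}", simplified] numeral_3_eq_3
      intro: finite_vec_box[where A = "\<lambda>_. {0, int L, 2 * int L}", simplified])

text \<open>The window has width \<open>3 * L\<close>, so wrapping is injective on it. Wrapped
  points have all coordinates in the range from 0 to \<open>3 * L - 1\<close>, the other images have
  none there, and the outer map is injective in each coordinate.\<close>

lemma inj_glue:
  assumes "L > 0"
  shows "inj (glue L p)"
proof (rule injI)
  fix x y assume eq: "glue L p x = glue L p y"
  let ?W = "\<lambda>x :: int ^ 'a. \<forall>i. - int L \<le> x $ i \<and> x $ i < 2 * int L"
  let ?o = "\<lambda>x :: int ^ 'a. \<chi> i. if x $ i \<ge> 0 then x $ i + 3 * int L else x $ i"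
  have g: "glue L p x = (if ?W x then tshift (cube_dims (3 * L)) p x else ?o x)" for x
    by (simp add: glue_def)
  have ne: "tshift (cube_dims (3 * L)) p x \<noteq> ?o y" for x y
  proof
    assume e: "tshift (cube_dims (3 * L)) p x = ?o y"
    fix i
    have "(p $ i + x $ i) mod (3 * int L) = (if y $ i \<ge> 0 then y $ i + 3 * int L else y $ i)"
      using e by (simp add: tshift_def vec_eq_iff)
    moreover have "0 \<le> (p $ i + x $ i) mod (3 * int L)" "(p $ i + x $ i) mod (3 * int L) < 3 * int L"
      using assms by auto
    ultimately show False by (auto split: if_splits)
  qed
  consider "?W x" "?W y" | "\<not> ?W x" "\<not> ?W y"
    using eq ne[of x y] ne[of y x] unfolding g by metis
  then show "x = y"
  proof cases
    case 1
    then have "tshift (cube_dims (3 * L)) p x = tshift (cube_dims (3 * L)) p y"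
      using eq unfolding g by simp
    then have d: "3 * int L dvd x $ i - y $ i" for i
      unfolding tshift_eq_iff by (auto dest!: spec[of _ i])
    have "x $ i = y $ i" for i
      by (rule eq_if_dvd_diff[OF d]) (use 1[rule_format, of i] in linarith)
    then show ?thesis by (simp add: vec_eq_iff)
  next
    case 2
    then have o: "?o x = ?o y" using eq unfolding g by (simp only: if_False)
    have "x $ i = y $ i" for i
    proof -
      have "?o x $ i = ?o y $ i" using o by simp
      then show ?thesis using assms by (auto split: if_splits)
    qed
    then show ?thesis by (simp add: vec_eq_iff)
  qed
qed

section \<open>Unique decomposition of torus points into a corner and a position in its box\<close>

lemma corner_plus_cube:
  assumes "p \<in> corners L" "x \<in> cube L"
  shows "p + x \<in> cube (3 * L)"
proof -
  have "0 \<le> (p + x) $ i \<and> (p + x) $ i < 3 * int L" for i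
    using assms by (auto simp: corners_def torus_def dest!: spec[of _ i])
  then show ?thesis by (simp add: torus_def)
qed

lemma corner_plus_cube_unique:
  assumes "p \<in> corners L" "x \<in> cube L" "p' \<in> corners L" "x' \<in> cube L" "p + x = p' + x'"
  shows "p = p' \<and> x = x'"
proof -
  have "x $ i = x' $ i" for i
  proof (rule eq_if_dvd_diff)
    have "x $ i - x' $ i = p' $ i - p $ i" using assms(5) by (simp add: vec_eq_iff algebra_simps)
    moreover have "int L dvd p' $ i" "int L dvd p $ i"
      using assms(1,3) by (auto simp: corners_def dest!: spec[of _ i])
    ultimately show "int L dvd x $ i - x' $ i" by simp
    show "\<bar>x $ i - x' $ i\<bar> < int L"
      using assms(2,4) by (auto simp: torus_def dest!: spec[of _ i])
  qed
  then have "x = x'" by (simp add: vec_eq_iff)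
  then show ?thesis using assms(5) by simp
qed

definition offset :: "nat \<Rightarrow> int ^ 'd::finite \<Rightarrow> int ^ 'd" where
  "offset L y = (\<chi> i. y $ i mod int L)"

lemma offset_in_cube: "L > 0 \<Longrightarrow> offset L y \<in> cube L"
  by (simp add: offset_def torus_def)

lemma corner_of_torus_point:
  assumes "y \<in> cube (3 * L)" "L > 0"
  shows "y - offset L y \<in> corners L"
proof -
  have "(y - offset L y) $ i \<in> {0, int L, 2 * int L}" for i
  proof -
    have y: "0 \<le> y $ i" "y $ i < 3 * int L" using assms(1) by (auto simp: torus_def dest!: spec[of _ i])
    have lower: "0 \<le> y $ i div int L"
      using y assms(2) by (simp add: pos_imp_zdiv_nonneg_iff)
    have "int L * (y $ i div int L) \<le> y $ i"
      using minus_mod_eq_mult_div[of "y $ i" "int L"] pos_mod_sign[of "int L" "y $ i"] assms(2)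
      by linarith
    then have "int L * (y $ i div int L) < int L * 3" using y by linarith
    then have "y $ i div int L < 3" by (rule mult_left_less_imp_less) simp
    then have "y $ i div int L \<in> {0, 1, 2}" using lower by auto
    moreover have "(y - offset L y) $ i = int L * (y $ i div int L)"
      by (simp add: offset_def minus_mod_eq_mult_div)
    ultimately show ?thesis by auto
  qed
  then show ?thesis by (simp add: corners_def)
qed

lemma offset_corner_plus:
  assumes "p \<in> corners L" "x \<in> cube L"
  shows "offset L (p + x) = x"
proof -
  have "L > 0" using assms(2) by (auto simp: torus_def dest!: spec)
  then show ?thesis
    using corner_plus_cube_unique[OF corner_of_torus_point[OF corner_plus_cube[OF assms]] offset_in_cube assms]
    by simp
qed

text \<open>The vertices matched inside the box come in pairs, while the box has the odd number
  \<open>L ^ CARD('d)\<close> of vertices.\<close>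

lemma odd_card_crossing:
  fixes \<sigma> :: "int ^ 'd::finite \<Rightarrow> int ^ 'd"
  assumes "odd L" "grid_valid PM_box \<sigma>"
  shows "odd (card {x \<in> cube L. x + \<sigma> x \<notin> cube L})"
proof -
  have s: "\<sigma> v \<in> box_vectors" "\<sigma> (v + \<sigma> v) = - \<sigma> v" for v
    using assms(2) unfolding PM_box_grid_valid_iff by (auto simp: PM_box_def)
  have "even (card {x \<in> cube L. x + \<sigma> x \<in> cube L})"
    by (rule even_card_if_involution[where h = "\<lambda>x. x + \<sigma> x"])
      (use s in \<open>auto simp: finite_torus box_vectors_def\<close>)
  moreover have "card {x \<in> cube L. x + \<sigma> x \<in> cube L} + card {x \<in> cube L. x + \<sigma> x \<notin> cube L} =
      card (cube L :: (int ^ 'd) set)"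
    by (subst card_Un_disjoint[symmetric]) (auto simp: finite_torus intro: arg_cong[where f = card])
  moreover have "odd (card (cube L :: (int ^ 'd) set))" using assms(1) by (simp add: card_cube)
  ultimately show ?thesis by presburger
qed

text \<open>The matchings \<open>\<sigma> p\<close> come from different labellings of the grid and
  need not fit together a priori. The radius bound makes them agree on edges leaving the boxes,
  which yields an involution on an odd set.\<close>

lemma glued_outputs_invalid:
  fixes \<omega> :: "int ^ 'd::finite \<Rightarrow> real" and f :: "nat \<Rightarrow> (int ^ 'd \<Rightarrow> real) \<Rightarrow> int ^ 'd"
  assumes L: "odd L" "3 \<le> L" "r + 2 \<le> L"
    and valid: "\<And>p. p \<in> corners L \<Longrightarrow> grid_valid PM_box (uniform_output \<C> f (\<omega> \<circ> glue L p))"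
    and radius: "\<And>p x. p \<in> corners L \<Longrightarrow> x \<in> layer L \<Longrightarrow> coding_radius \<C> (\<omega> \<circ> glue L p) x \<le> enat r"
  shows False
proof -
  let ?N = "cube_dims (3 * L) :: nat ^ 'd"
  define \<sigma> where "\<sigma> p = uniform_output \<C> f (\<omega> \<circ> glue L p)" for p
  have s: "\<sigma> p v \<in> box_vectors" "\<sigma> p (v + \<sigma> p v) = - \<sigma> p v" if "p \<in> corners L" for p v
    using valid[OF that] unfolding PM_box_grid_valid_iff \<sigma>_def by (auto simp: PM_box_def)
  define S where "S = (SIGMA p : corners L. {x \<in> cube L. x + \<sigma> p x \<notin> cube L})"
  have fin: "finite S"
    unfolding S_def using L(2) card_corners(1)[of L] by (intro finite_SigmaI) (auto simp: finite_torus)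
  have "card S = (\<Sum>p\<in>corners L. card {x \<in> cube L. x + \<sigma> p x \<notin> cube L})"
    unfolding S_def using L(2) card_corners(1)[of L] by (intro card_SigmaI) (auto simp: finite_torus)
  \<comment> \<open>All summands are odd, so the sum has the parity of the number
    \<open>3 ^ CARD('d)\<close> of corners.\<close>
  moreover have "{p \<in> corners L. odd (card {x \<in> cube L. x + \<sigma> p x \<notin> cube L})} = corners L"
    using odd_card_crossing[OF L(1)] valid unfolding \<sigma>_def by auto
  ultimately have odd: "odd (card S)"
    using L(2) card_corners[of L, where 'd = 'd] by (simp add: even_sum_iff)

  \<comment> \<open>The matching edge at \<open>x\<close> is followed in the torus, and its other
    end is rewritten as a corner and a position.\<close>
  define h where "h = (\<lambda>(p, x). let y = tshift ?N p (x + \<sigma> p x) in (y - offset L y, offset L y))"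
  have "h (p, x) \<in> S \<and> h (p, x) \<noteq> (p, x) \<and> h (h (p, x)) = (p, x)" if "(p, x) \<in> S" for p x
  proof -
    have p: "p \<in> corners L" and x: "x \<in> cube L" and out: "x + \<sigma> p x \<notin> cube L"
      using that by (auto simp: S_def)
    let ?z = "x + \<sigma> p x"
    define y where "y = tshift ?N p ?z"
    define x' where "x' = offset L y"
    define p' where "p' = y - x'"
    have hpx: "h (p, x) = (p', x')" by (simp add: h_def y_def x'_def p'_def Let_def)
    have px: "tshift ?N p x = p + x"
      using tshift_zero[OF corner_plus_cube[OF p x]] by (simp add: tshift_def)
    have y: "y \<in> torus ?N"
      unfolding y_def using tshift_in_torus[OF corner_plus_cube[OF p x], of "\<sigma> p x"]
      by (simp add: px[symmetric] tshift_tshift)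
    have x': "x' \<in> cube L" unfolding x'_def using L(2) by (intro offset_in_cube) simp
    have p': "p' \<in> corners L" unfolding p'_def x'_def using L(2) y by (intro corner_of_torus_point) auto
    have y': "tshift ?N p' x' = y"
      using tshift_zero[OF y] by (simp add: tshift_def p'_def)
    have shift: "tshift ?N p' (x' + u) = tshift ?N p (?z + u)" for u
      using y' by (simp add: tshift_tshift[symmetric] y_def)
    have small: "\<bar>\<sigma> p x $ i\<bar> \<le> 2" for i
      using s(1)[OF p, of x] abs_le_l1[of "\<sigma> p x" i] by (simp add: box_vectors_def)
    have xb: "0 \<le> x $ i" "x $ i < int L" and xb': "0 \<le> x' $ i" "x' $ i < int L" for i
      using x x' by (auto simp: torus_def)
    have shift_back: "tshift ?N p' (x' - \<sigma> p x) = p + x"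
      using shift[of "- \<sigma> p x"] px by simp
    \<comment> \<open>The partner of x lies in the box at the corner p', near its boundary, and is at x' as seen from there.\<close>
    have "x' \<noteq> ?z" using x' out by auto
    \<comment> \<open>The edge leaves the box from its other end too: otherwise the torus vertex
      \<open>p + x\<close> would have two decompositions, and their equality would put
      \<open>?z\<close> back into the box.\<close>
    have out': "x' - \<sigma> p x \<notin> cube L"
    proof
      assume w: "x' - \<sigma> p x \<in> cube L"
      have "tshift ?N p' (x' - \<sigma> p x) = p' + (x' - \<sigma> p x)"
        using tshift_zero[OF corner_plus_cube[OF p' w]] by (simp add: tshift_def)
      then have "p' + (x' - \<sigma> p x) = p + x" using shift_back by (rule trans[OF sym])
      then have "x' - \<sigma> p x = x" using corner_plus_cube_unique[OF p' w p x] by blast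
      then show False using \<open>x' \<noteq> ?z\<close> by (simp only: diff_eq_eq)
    qed
    have "- \<sigma> p x \<in> box_vectors" using s(1)[OF p, of x] by (simp add: box_vectors_def l1_uminus)
    then have "x' \<in> layer L"
      unfolding layer_def using x' out' by (auto intro!: bexI[of _ "- \<sigma> p x"])
    then have rad: "coding_radius \<C> (\<omega> \<circ> glue L p') x' \<le> enat r" using radius p' by blast
    \<comment> \<open>Both runs read the same torus labels, since \<open>?z\<close> seen from
      \<open>p\<close> and \<open>x'\<close> seen from \<open>p'\<close> are the same torus
      vertex.\<close>
    have "uniform_output \<C> f (\<omega> \<circ> glue L p) ?z = uniform_output \<C> f (\<omega> \<circ> glue L p') x'"
    proof (rule uniform_output_local[OF rad])
      fix u :: "int ^ 'd" assume "u \<in> gball r"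
      then have u: "\<bar>u $ i\<bar> \<le> int r" for i
        using abs_le_l1[of u i] by (simp add: gball_def)
      have "- int L \<le> (x' + u) $ i \<and> (x' + u) $ i < 2 * int L" for i
        unfolding vector_add_component using u[of i] xb'[of i] L(2,3) by linarith
      \<comment> \<open>The point \<open>?z\<close> may lie two steps outside the box, so
        \<open>r + 2 \<le> L\<close> is exactly what keeps its ball in the window.\<close>
      moreover have "- int L \<le> (?z + u) $ i \<and> (?z + u) $ i < 2 * int L" for i
        unfolding vector_add_component using u[of i] xb[of i] small[of i] L(2,3) by linarith
      ultimately show "(\<omega> \<circ> glue L p') (x' + u) = (\<omega> \<circ> glue L p) (?z + u)"
        using shift[of u] by (simp add: glue_def del: vector_add_component)
    qed
    then have s': "\<sigma> p' x' = - \<sigma> p x" using s(2)[OF p, of x] by (simp add: \<sigma>_def)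
    have "(p', x') \<in> S" using p' x' out' s' by (simp add: S_def)
    moreover have "(p', x') \<noteq> (p, x)"
    proof
      assume "(p', x') = (p, x)"
      then have "\<sigma> p x = - \<sigma> p x" using s' by simp
      then have "\<sigma> p x = 0" by (simp add: vec_eq_iff)
      then show False using s(1)[OF p, of x] by (simp add: box_vectors_def)
    qed
    moreover have "h (p', x') = (p, x)"
      using shift_back s' offset_corner_plus[OF p x] by (simp add: h_def Let_def)
    ultimately show ?thesis by (simp add: hpx)
  qed
  then have "even (card S)"
    by (intro even_card_if_involution[OF fin, of h]) auto
  then show False using odd by simp
qed

section \<open>Size of the boundary layer and the union bound\<close>

text \<open>A short vector moves each coordinate by at most 2, so some coordinate of a layer vertex
  is among the two outermost values at either end. There are \<open>CARD('d)\<close> choices of it,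
  at most 4 values for it, and \<open>L\<close> values for each remaining coordinate.\<close>

lemma card_layer_le:
  assumes "L > 0"
  shows "finite (layer L :: (int ^ 'd::finite) set)"
    and "card (layer L :: (int ^ 'd) set) \<le> 4 * CARD('d) * L ^ (CARD('d) - 1)"
proof -
  show "finite (layer L :: (int ^ 'd) set)" by (simp add: layer_def finite_torus)
  define B :: "'d \<Rightarrow> 'd \<Rightarrow> int set" where
    "B i j = (if j = i then {0, 1, int L - 2, int L - 1} else {0..<int L})" for i j
  have "layer L \<subseteq> (\<Union>i\<in>UNIV. {x :: int ^ 'd. \<forall>j. x $ j \<in> B i j})"
  proof
    fix x :: "int ^ 'd" assume "x \<in> layer L"
    then obtain \<delta> where x: "x \<in> cube L" and \<delta>: "l1 \<delta> \<le> 2" and out: "x + \<delta> \<notin> cube L"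
      by (auto simp: layer_def box_vectors_def)
    have xb: "0 \<le> x $ j" "x $ j < int L" for j using x by (auto simp: torus_def)
    obtain i where i: "\<not> (0 \<le> x $ i + \<delta> $ i \<and> x $ i + \<delta> $ i < int L)"
      using out by (auto simp: torus_def)
    have "x $ i \<in> {0, 1, int L - 2, int L - 1}"
      using i xb[of i] \<delta> abs_le_l1[of \<delta> i] by auto
    then have "\<forall>j. x $ j \<in> B i j" using xb by (auto simp: B_def)
    then show "x \<in> (\<Union>i\<in>UNIV. {x :: int ^ 'd. \<forall>j. x $ j \<in> B i j})" by blast
  qed
  moreover have fin: "finite {x :: int ^ 'd. \<forall>j. x $ j \<in> B i j}" for i
    by (rule finite_vec_box) (simp add: B_def)
  ultimately have "card (layer L :: (int ^ 'd) set) \<le> card (\<Union>i\<in>UNIV. {x :: int ^ 'd. \<forall>j. x $ j \<in> B i j})"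
    by (intro card_mono) auto
  also have "\<dots> \<le> (\<Sum>i\<in>UNIV. card {x :: int ^ 'd. \<forall>j. x $ j \<in> B i j})"
    by (rule card_UN_le) simp
  also have "\<dots> \<le> (\<Sum>i\<in>(UNIV :: 'd set). 4 * L ^ (CARD('d) - 1))"
  proof (rule sum_mono)
    fix i :: 'd
    have four: "card (B i i) \<le> 4"
      unfolding B_def by (auto intro!: order_trans[OF card_insert_le_m1])
    have "card {x :: int ^ 'd. \<forall>j. x $ j \<in> B i j} = card (B i i) * (\<Prod>j\<in>UNIV - {i}. card (B i j))"
      unfolding card_vec_box by (rule prod.remove) auto
    also have "(\<Prod>j\<in>UNIV - {i}. card (B i j)) = (\<Prod>j\<in>UNIV - {i}. L)"
      by (rule prod.cong) (auto simp: B_def)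
    also have "\<dots> = L ^ (CARD('d) - 1)" by simp
    finally show "card {x :: int ^ 'd. \<forall>j. x $ j \<in> B i j} \<le> 4 * L ^ (CARD('d) - 1)"
      using four by simp
  qed
  finally show "card (layer L :: (int ^ 'd) set) \<le> 4 * CARD('d) * L ^ (CARD('d) - 1)"
    by (simp add: algebra_simps)
qed

text \<open>Almost surely all glued runs are valid, so some layer vertex in some box must have
  radius above \<open>L - 2\<close>. These finitely many events have equal probability, and the
  union bound applies.\<close>

lemma coding_radius_tail_ge:
  fixes f :: "nat \<Rightarrow> (int ^ 'd::finite \<Rightarrow> real) \<Rightarrow> int ^ 'd"
  assumes L: "odd L" "3 \<le> L"
    and C: "\<And>s. \<C> s \<in> sets (ball_space s)"
    and solves: "uniform_solves \<C> f PM_box"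
  shows "1 \<le> real (3 ^ CARD('d) * (4 * CARD('d) * L ^ (CARD('d) - 1))) *
    measure label_measure {\<omega> \<in> space label_measure. ereal_of_enat (coding_radius \<C> \<omega> 0) > ereal (real (L - 2))}"
    (is "1 \<le> real ?n * ?q")
proof -
  interpret prob_space "label_measure :: (int ^ 'd \<Rightarrow> real) measure"
    by (rule prob_space_label_measure)
  let ?I = "corners L \<times> layer L :: ((int ^ 'd) \<times> (int ^ 'd)) set"
  define F where "F = (\<lambda>(p, x). {\<omega> \<in> space label_measure.
    ereal_of_enat (coding_radius \<C> (\<omega> \<circ> glue L p) x) > ereal (real (L - 2))})"
  have Lpos: "L > 0" using L by simp
  have F: "F i \<in> sets label_measure" "measure label_measure (F i) = ?q" for i
    unfolding F_def using measure_coding_radius_reindex[OF C inj_glue[OF Lpos]]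
    by (auto split: prod.split)
  have fin: "finite ?I" using card_corners(1)[OF Lpos] card_layer_le(1)[OF Lpos] by blast
  have "AE \<omega> in label_measure. grid_valid PM_box (uniform_output \<C> f \<omega>)"
    using solves unfolding uniform_solves_def by auto
  then have "AE \<omega> in label_measure. grid_valid PM_box (uniform_output \<C> f (\<omega> \<circ> glue L p))" for p
    by (rule AE_reindex[OF inj_glue[OF Lpos]])
  then have "AE \<omega> in label_measure. \<forall>p\<in>corners L. grid_valid PM_box (uniform_output \<C> f (\<omega> \<circ> glue L p))"
    using card_corners(1)[OF Lpos] by (intro AE_finite_allI) auto
  then have "AE \<omega> in label_measure. \<omega> \<in> (\<Union>i\<in>?I. F i)"
  proof (rule AE_mp, intro AE_I2 impI)
    fix \<omega> :: "int ^ 'd \<Rightarrow> real"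
    assume sp: "\<omega> \<in> space label_measure"
      and v: "\<forall>p\<in>corners L. grid_valid PM_box (uniform_output \<C> f (\<omega> \<circ> glue L p))"
    show "\<omega> \<in> (\<Union>i\<in>?I. F i)"
    proof (rule ccontr)
      assume n: "\<omega> \<notin> (\<Union>i\<in>?I. F i)"
      have "coding_radius \<C> (\<omega> \<circ> glue L p) x \<le> enat (L - 2)"
        if "p \<in> corners L" "x \<in> layer L" for p x
      proof -
        have "\<omega> \<notin> F (p, x)" using n that by blast
        then have "ereal_of_enat (coding_radius \<C> (\<omega> \<circ> glue L p) x) \<le> ereal_of_enat (enat (L - 2))"
          using sp by (auto simp: F_def not_less)
        then show ?thesis by (simp only: ereal_of_enat_le_iff)
      qed
      moreover have "L - 2 + 2 \<le> L" using L(2) by linarith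
      ultimately show False
        using glued_outputs_invalid[OF L _ v[rule_format], of "L - 2"] by blast
    qed
  qed
  then have "1 = prob (\<Union>i\<in>?I. F i)"
    using F(1) fin by (subst eq_commute, subst prob_eq_1) auto
  also have "\<dots> \<le> (\<Sum>i\<in>?I. prob (F i))"
    using F(1) fin by (intro finite_measure_subadditive_finite) auto
  also have "\<dots> = real (card ?I) * ?q" by (simp add: F(2))
  also have "\<dots> \<le> real ?n * ?q"
    using card_corners(2)[OF Lpos, where 'd = 'd] card_layer_le(2)[OF Lpos, where 'd = 'd]
    by (intro mult_right_mono) (simp_all only: card_cartesian_product of_nat_le_iff mult_le_mono2 measure_nonneg)
  finally show ?thesis .
qed

subsection \<open>Uniform algorithms\<close>

theorem PM_box_notin_ULOCAL:
  assumes "2 \<le> CARD('d::finite)"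
  shows "(PM_box :: ('d, int ^ 'd) grid_problem) \<notin>
    ULOCAL (o[at_right 0](\<lambda>\<epsilon>. root (CARD('d) - 1) (1 / \<epsilon>)))"
proof
  let ?m = "CARD('d) - 1"
  assume "(PM_box :: ('d, int ^ 'd) grid_problem) \<in> ULOCAL (o[at_right 0](\<lambda>\<epsilon>. root ?m (1 / \<epsilon>)))"
  then obtain t \<C> and f :: "nat \<Rightarrow> (int ^ 'd \<Rightarrow> real) \<Rightarrow> int ^ 'd"
    where t: "t \<in> o[at_right 0](\<lambda>\<epsilon>. root ?m (1 / \<epsilon>))"
      and alg: "uniform_alg (out_labels (PM_box :: ('d, int ^ 'd) grid_problem)) \<C> f"
      and comp: "uniform_complexity \<C> t" and solves: "uniform_solves \<C> f PM_box"
    by (auto simp: ULOCAL_def)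
  have C: "\<C> s \<in> sets (ball_space s)" for s using alg by (auto simp: uniform_alg_def)
  \<comment> \<open>Twice the constant of the union bound, so that a tail of at most
    \<open>e L\<close> leaves total probability at most 1/2.\<close>
  define K where "K = real (2 * (3 ^ CARD('d) * (4 * CARD('d))))"
  have m: "0 < ?m" using assms by simp
  have K: "0 < K" by (simp add: K_def)
  \<comment> \<open>As the root of \<open>1 / e L\<close> is \<open>root ?m K * L\<close>, this
    choice gives \<open>t (e L) \<le> L / 2\<close>, which is at most \<open>L - 2\<close> once
    \<open>L \<ge> 4\<close>.\<close>
  define c where "c = 1 / (2 * root ?m K)"
  have c: "0 < c" using K m by (simp add: c_def)
  define e where "e L = 1 / (K * real L ^ ?m)" for L :: nat
  have "\<forall>\<^sub>F \<epsilon> in at_right 0. \<bar>t \<epsilon>\<bar> \<le> c * \<bar>root ?m (1 / \<epsilon>)\<bar> \<and>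
      measure label_measure {\<omega> \<in> space label_measure. ereal_of_enat (coding_radius \<C> \<omega> 0) > ereal (t \<epsilon>)} \<le> \<epsilon>"
    using landau_o.smallD[OF t c] comp unfolding uniform_complexity_def by (intro eventually_conj) auto
  moreover have "filterlim e (at_right 0) at_top"
    unfolding e_def using K m by real_asymp
  ultimately have "\<forall>\<^sub>F L in at_top. \<bar>t (e L)\<bar> \<le> c * \<bar>root ?m (1 / e L)\<bar> \<and>
      measure label_measure {\<omega> \<in> space label_measure. ereal_of_enat (coding_radius \<C> \<omega> 0) > ereal (t (e L))} \<le> e L"
    by (rule eventually_compose_filterlim)
  then obtain M where M: "\<And>L. L \<ge> M \<Longrightarrow> \<bar>t (e L)\<bar> \<le> c * \<bar>root ?m (1 / e L)\<bar> \<and>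
      measure label_measure {\<omega> \<in> space label_measure. ereal_of_enat (coding_radius \<C> \<omega> 0) > ereal (t (e L))} \<le> e L"
    by (auto simp: eventually_at_top_linorder)
  define L where "L = 2 * M + 5"
  have L: "odd L" "5 \<le> L" "M \<le> L" by (auto simp: L_def)
  have "root ?m (1 / e L) = root ?m K * real L"
    using m by (simp add: e_def real_root_mult real_root_power_cancel)
  then have "c * \<bar>root ?m (1 / e L)\<bar> = real L / 2"
    using K m by (simp add: c_def)
  then have "t (e L) \<le> real (L - 2)" using M[OF L(3)] L(2) by linarith
  then have sub: "{\<omega> \<in> space label_measure. ereal_of_enat (coding_radius \<C> \<omega> 0) > ereal (real (L - 2))}
      \<subseteq> {\<omega> \<in> space label_measure. ereal_of_enat (coding_radius \<C> \<omega> 0) > ereal (t (e L))}"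
    using ereal_less_eq(3) le_less_trans by blast
  interpret prob_space "label_measure :: (int ^ 'd \<Rightarrow> real) measure"
    by (rule prob_space_label_measure)
  have "1 \<le> real (3 ^ CARD('d) * (4 * CARD('d) * L ^ ?m)) *
      measure label_measure {\<omega> \<in> space label_measure. ereal_of_enat (coding_radius \<C> \<omega> 0) > ereal (real (L - 2))}"
    using L C solves by (intro coding_radius_tail_ge) auto
  also have "\<dots> \<le> real (3 ^ CARD('d) * (4 * CARD('d) * L ^ ?m)) * e L"
    using finite_measure_mono[OF sub sets_coding_radius_greater[OF C]] M[OF L(3)]
    by (intro mult_left_mono) auto
  also have "\<dots> = 1 / 2" using L(2) by (simp add: e_def K_def)
  finally show False by simp
qed

theorem claim6p1:
  fixes a b :: real and k :: nat
  assumes "2 \<le> CARD('d::finite)"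
    and "0 < a" and "a \<le> 1" and "1 \<le> b" and "1 \<le> k"
  shows "(PM_box :: ('d, int ^ 'd) grid_problem) \<notin> LOCAL a b k (O(\<lambda>n. real (log_star (real n))))
    \<and> (PM_box :: ('d, int ^ 'd) grid_problem) \<notin>
           ULOCAL (o[at_right 0](\<lambda>\<epsilon>. root (CARD('d) - 1) (1 / \<epsilon>)))"
  using PM_box_notin_LOCAL[OF assms(3,4,5)] PM_box_notin_ULOCAL[OF assms(1)] by blast

end
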